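(* Let $\mathcal P$ be the Petersen graph on $H=\{a_1,a_2,a_3,b_1,b_2,\tilde b_3,c_2,c_3,c_4,c_5\}$ with edges $c_4c_2, c_2\tilde b_3, \tilde b_3a_1, a_1c_5, c_5c_4, c_4c_3, c_2a_3, \tilde b_3b_2, a_1a_2, c_5b_1, c_3b_2, b_2b_1, b_1a_3, a_3a_2, a_2c_3$; write $a\sim b$ for adjacency and $\mathrm{cl}(b)=\{b\}\cup\{a:a\sim b\}$. In $R=\mathbb{Q}[\beta,\ell_b:b\in H]$ let $\mathcal I$ be the ideal generated by $\ell_b-\sum_{a\sim b}\ell_a$ ($b\in H$). Put $u_b^\pm=\tfrac12(\ell_b\pm\beta)$, and for $J\subseteq H$ put $X^J=\prod_{b\notin J}u_b^+\prod_{b\in J}u_b^-$ and $\bar X^J=\prod_{b\notin J}u_b^-\prod_{b\in J}u_b^+$. Let $F=7X^{\emptyset}-2\sum_{b}X^{\{b\}}+\sum_{\{a,b\}\text{ edge}}X^{\{a,b\}}$. Then for every $b\in H$: (i) $F\equiv X^{\mathrm{cl}(b)}$ modulo the ideal $\mathcal I+(u_b^+)$; (ii) $F\equiv \bar X^{\mathrm{cl}(b)}$ modulo the ideal $\mathcal I+(u_b^-)$. In particular, on each of the $20$ hyperplanes $u_b^{\pm}=0$ of the hook space, $F$ agrees with a single product of $10$ linear factors.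
   Context: Interpretation: $F$ is the paper's Jack Littlewood–Richardson polynomial for the triple $(21,21,321)$ written in $\ell$-coordinates; $u_b^+$ (resp. $u_b^-$) is the signed hook symbol of box $b$ in the reference Stanley diagram $X$ (resp. its flip), $\beta$ evaluates to $\alpha-1$, and $\mathbb{Q}[\beta,\ell]/\mathcal I$ is the hook space. $X^{\mathrm{cl}(b)}$ and $\bar X^{\mathrm{cl}(b)}$ are the "boundary data": the reference diagram with the hooks on $\mathrm{cl}(b)$ flipped, and its complement. *)

theory Defs
  imports Complex_Main "HOL-Library.Poly_Mapping" "HOL-Library.Set_Algebras"
begin

text \<open>\<open>Bt3\<close> is the hook written \<open>b\<^sub>3\<close> with a tilde.\<close>

datatype hook = A1 | A2 | A3 | B1 | B2 | Bt3 | C2 | C3 | C4 | C5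

lemma UNIV_hook: "(UNIV :: hook set) = {A1, A2, A3, B1, B2, Bt3, C2, C3, C4, C5}"
  using hook.exhaust by blast

instance hook :: finite
  by standard (simp add: UNIV_hook)

definition petersen_edges :: "hook set set" where
  "petersen_edges =
    {{C4, C2}, {C2, Bt3}, {Bt3, A1}, {A1, C5}, {C5, C4},
     {C4, C3}, {C2, A3}, {Bt3, B2}, {A1, A2}, {C5, B1},
     {C3, B2}, {B2, B1}, {B1, A3}, {A3, A2}, {A2, C3}}"

definition adj :: "hook \<Rightarrow> hook \<Rightarrow> bool" (infix "\<sim>" 50) where
  "a \<sim> b \<longleftrightarrow> {a, b} \<in> petersen_edges"

definition cl :: "hook \<Rightarrow> hook set" where
  "cl b = {b} \<union> {a. a \<sim> b}"

text \<open>
  The ring \<open>\<rat>[\<beta>, \<ell>\<^sub>b : b \<in> H]\<close>: a polynomial maps each monomial (a finitely supported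
  exponent vector on the variables) to its coefficient, and multiplication is convolution.
\<close>

datatype var = Beta | Ell hook

type_synonym hpoly = "(var \<Rightarrow>\<^sub>0 nat) \<Rightarrow>\<^sub>0 rat"

definition const :: "rat \<Rightarrow> hpoly" where
  "const c = Poly_Mapping.single 0 c"

definition indet :: "var \<Rightarrow> hpoly" where
  "indet v = Poly_Mapping.single (Poly_Mapping.single v 1) 1"

abbreviation \<beta> :: hpoly where
  "\<beta> \<equiv> indet Beta"

abbreviation ell :: "hook \<Rightarrow> hpoly" where
  "ell b \<equiv> indet (Ell b)"

text \<open>The ideal generated by a set is its span in the ring viewed as a module over itself.\<close>

definition ideal_gen :: "'a::comm_ring_1 set \<Rightarrow> 'a set" where
  "ideal_gen S = module.span (*) S"

definition hook_ideal :: "hpoly set" where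
  "hook_ideal = ideal_gen (range (\<lambda>b. ell b - (\<Sum>a | a \<sim> b. ell a)))"

definition u_plus :: "hook \<Rightarrow> hpoly" where
  "u_plus b = const (1/2) * (ell b + \<beta>)"

definition u_minus :: "hook \<Rightarrow> hpoly" where
  "u_minus b = const (1/2) * (ell b - \<beta>)"

definition X :: "hook set \<Rightarrow> hpoly" where
  "X J = (\<Prod>b\<in>-J. u_plus b) * (\<Prod>b\<in>J. u_minus b)"

definition X_bar :: "hook set \<Rightarrow> hpoly" where
  "X_bar J = (\<Prod>b\<in>-J. u_minus b) * (\<Prod>b\<in>J. u_plus b)"

definition F :: hpoly where
  "F = 7 * X {} - 2 * (\<Sum>b\<in>UNIV. X {b}) + (\<Sum>e\<in>petersen_edges. X e)"

definition eval_at :: "(var \<Rightarrow> rat) \<Rightarrow> hpoly \<Rightarrow> rat" where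
  "eval_at x p = (\<Sum>m\<in>Poly_Mapping.keys p.
     Poly_Mapping.lookup p m * (\<Prod>v\<in>Poly_Mapping.keys m. x v ^ Poly_Mapping.lookup m v))"

text \<open>The (rational) points of the hook space, i.e. of the zero locus of \<open>hook_ideal\<close>.\<close>

definition hook_space :: "(var \<Rightarrow> rat) set" where
  "hook_space = {x. \<forall>p\<in>hook_ideal. eval_at x p = 0}"

definition hyperplane :: "hpoly \<Rightarrow> (var \<Rightarrow> rat) set" where
  "hyperplane u = {x \<in> hook_space. eval_at x u = 0}"

definition hook_hyperplanes :: "(var \<Rightarrow> rat) set set" where
  "hook_hyperplanes = range (\<lambda>b. hyperplane (u_plus b)) \<union> range (\<lambda>b. hyperplane (u_minus b))"

definition linear_form :: "hpoly \<Rightarrow> bool" where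
  "linear_form p \<longleftrightarrow> p \<noteq> 0 \<and> (\<forall>m\<in>Poly_Mapping.keys p. \<exists>v. m = Poly_Mapping.single v 1)"

end

theory Submission
  imports Defs
begin

text \<open>
  Fix a hook \<open>b\<close> with neighbours \<open>n\<^sub>i\<close>. The other six hooks form a hexagon; colour it alternately
  \<open>x\<^sub>i\<close>, \<open>y\<^sub>i\<close> so that \<open>n\<^sub>i\<close> is joined to the antipodal pair \<open>x\<^sub>i\<close>, \<open>y\<^sub>i\<close>. Writing a hook also for its
  \<open>u\<^sup>+\<close>, we have \<open>u\<^sup>- = u\<^sup>+ - \<beta>\<close>, and the relation at \<open>a\<close> says that \<open>a\<close> is the sum of its neighbours minus \<open>\<beta>\<close>.

  If \<open>b = 0\<close>, then \<open>n\<^sub>1 + n\<^sub>2 + n\<^sub>3 = \<beta>\<close> and only the terms of \<open>F\<close> that flip \<open>b\<close> survive; what remains is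
  a cubic identity in the \<open>n\<^sub>i\<close>. If \<open>b = \<beta>\<close>, the relations become \<open>n\<^sub>i = x\<^sub>i + y\<^sub>i\<close>,
  \<open>x\<^sub>1 + x\<^sub>2 + x\<^sub>3 = \<beta>\<close> and \<open>y\<^sub>1 + y\<^sub>2 + y\<^sub>3 = \<beta>\<close>. The terms that flip \<open>n\<^sub>i\<close> then combine into a multiple of
  \<open>n\<^sub>1 n\<^sub>2 n\<^sub>3\<close>, and after dividing by \<open>\<beta> n\<^sub>1 n\<^sub>2 n\<^sub>3\<close> an identity of degree six on the hexagon is left.

  The twenty hyperplanes are told apart by two eigenvectors of the graph for the eigenvalue 1:
  one that vanishes exactly at \<open>b\<close>, and one with value 1 at \<open>b\<close>.
\<close>

section \<open>Polynomial identities around one hook\<close>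

lemma star_identity:
  fixes t n1 n2 n3 :: "'a::comm_ring_1"
  assumes "n1 + n2 + n3 = t"
  shows "2 * (n1 * n2 * n3) - (n1 - t) * n2 * n3 - n1 * (n2 - t) * n3 - n1 * n2 * (n3 - t)
       = - ((n1 - t) * (n2 - t) * (n3 - t))"
  unfolding assms[symmetric] by (simp add: algebra_simps)

text \<open>The terms in \<open>t^2\<close> and \<open>t^3\<close> cancel because the sum is
  \<open>t\<close>; \<open>star_identity\<close> rests on the same cancellation.\<close>

lemma prod_minus_sum:
  fixes t x1 x2 x3 :: "'a::comm_ring_1"
  assumes "x1 + x2 + x3 = t"
  shows "(x1 - t) * (x2 - t) * (x3 - t) = x1 * x2 * x3 - t * (x2 * x3 + x1 * x3 + x1 * x2)"
  unfolding assms[symmetric] by (simp add: algebra_simps)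

text \<open>Once \<open>prod_minus_sum\<close> has rewritten the right side, the identity holds
  coefficientwise in \<open>t\<close>. For \<open>t^2\<close>, the six edges supply the pairs (x_i,
  y_j) with i and j distinct and the last bracket the antipodal pairs, which together give the
  product of the second elementary symmetric polynomials.\<close>

lemma hexagon_identity:
  fixes t x1 x2 x3 y1 y2 y3 :: "'a::comm_ring_1"
  assumes x: "x1 + x2 + x3 = t" and y: "y1 + y2 + y3 = t"
  shows "7 * (x1*x2*x3*y1*y2*y3)
     - 2 * ((x1-t)*x2*x3*y1*y2*y3 + x1*(x2-t)*x3*y1*y2*y3 + x1*x2*(x3-t)*y1*y2*y3
          + x1*x2*x3*(y1-t)*y2*y3 + x1*x2*x3*y1*(y2-t)*y3 + x1*x2*x3*y1*y2*(y3-t))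
     + ((x1-t)*x2*x3*y1*(y2-t)*y3 + (x1-t)*x2*x3*y1*y2*(y3-t)
      + x1*(x2-t)*x3*(y1-t)*y2*y3 + x1*(x2-t)*x3*y1*y2*(y3-t)
      + x1*x2*(x3-t)*(y1-t)*y2*y3 + x1*x2*(x3-t)*y1*(y2-t)*y3)
     - t * ((x1+y1-t)*x2*x3*y2*y3 + (x2+y2-t)*x1*x3*y1*y3 + (x3+y3-t)*x1*x2*y1*y2)
     = (x1-t)*(x2-t)*(x3-t)*((y1-t)*(y2-t)*(y3-t))"
  unfolding prod_minus_sum[OF x] prod_minus_sum[OF y] by (simp add: algebra_simps)

text \<open>Combines the three terms of \<open>F\<close> that flip n_i but not \<open>b\<close>: the
  edges to x_i and y_i, and twice the single flip. The products \<open>x*y\<close> cancel, and the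
  factor \<open>x+y\<close> that appears is n_i itself.\<close>

lemma spoke_identity:
  fixes t :: "'a::comm_ring_1"
  shows "(x+y-t)*((x-t)*y*c + x*(y-t)*c) - 2*((x+y-t)*(x*y*c)) = - (t * (x+y) * ((x+y-t)*c))"
  by (simp add: algebra_simps)

section \<open>Flipped products and coordinates on the graph\<close>

definition flip_prod :: "('b::finite \<Rightarrow> 'a::comm_ring_1) \<Rightarrow> ('b \<Rightarrow> 'a) \<Rightarrow> 'b set \<Rightarrow> 'a" where
  "flip_prod U V J = (\<Prod>a\<in>UNIV. if a \<in> J then V a else U a)"

text \<open>
  \<open>F\<close> as a function of the hook symbols, so that these can be replaced by congruent elements
  that satisfy the relations exactly.
\<close>

definition lr_poly :: "(hook \<Rightarrow> 'a::comm_ring_1) \<Rightarrow> (hook \<Rightarrow> 'a) \<Rightarrow> 'a" where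
  "lr_poly U V = 7 * flip_prod U V {} - 2 * (\<Sum>b\<in>UNIV. flip_prod U V {b})
     + (\<Sum>e\<in>petersen_edges. flip_prod U V e)"

lemma flip_prod_split: "flip_prod U V J = (\<Prod>b\<in>-J. U b) * (\<Prod>b\<in>J. V b)"
proof -
  have "flip_prod U V J = (\<Prod>b\<in>J. V b) * (\<Prod>b\<in>-J. U b)"
    unfolding flip_prod_def by (subst prod.If_cases) (auto simp: Compl_eq)
  then show ?thesis by (simp add: mult.commute)
qed

lemma F_eq_lr_poly: "F = lr_poly u_plus u_minus"
  and X_eq_flip_prod: "X J = flip_prod u_plus u_minus J"
  and X_bar_eq_flip_prod: "X_bar J = flip_prod u_minus u_plus J"
  by (simp_all add: F_def lr_poly_def X_def X_bar_def flip_prod_split)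

text \<open>The graph as seen from \<open>b\<close>. One calculation in these coordinates serves all
  ten hooks.\<close>

locale petersen_frame =
  fixes b n1 n2 n3 x1 x2 x3 y1 y2 y3 :: hook
  assumes distinct_frame: "distinct [b, n1, n2, n3, x1, x2, x3, y1, y2, y3]"
    and edges: "petersen_edges =
      {{b, n1}, {b, n2}, {b, n3}, {n1, x1}, {n1, y1}, {n2, x2}, {n2, y2}, {n3, x3}, {n3, y3},
       {x1, y2}, {x1, y3}, {x2, y1}, {x2, y3}, {x3, y1}, {x3, y2}}"
begin

lemma neqs: "b \<noteq> n1" "b \<noteq> n2" "b \<noteq> n3" "b \<noteq> x1" "b \<noteq> x2" "b \<noteq> x3" "b \<noteq> y1" "b \<noteq> y2" "b \<noteq> y3"
  "n1 \<noteq> n2" "n1 \<noteq> n3" "n1 \<noteq> x1" "n1 \<noteq> x2" "n1 \<noteq> x3" "n1 \<noteq> y1" "n1 \<noteq> y2" "n1 \<noteq> y3"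
  "n2 \<noteq> n3" "n2 \<noteq> x1" "n2 \<noteq> x2" "n2 \<noteq> x3" "n2 \<noteq> y1" "n2 \<noteq> y2" "n2 \<noteq> y3"
  "n3 \<noteq> x1" "n3 \<noteq> x2" "n3 \<noteq> x3" "n3 \<noteq> y1" "n3 \<noteq> y2" "n3 \<noteq> y3"
  "x1 \<noteq> x2" "x1 \<noteq> x3" "x1 \<noteq> y1" "x1 \<noteq> y2" "x1 \<noteq> y3"
  "x2 \<noteq> x3" "x2 \<noteq> y1" "x2 \<noteq> y2" "x2 \<noteq> y3" "x3 \<noteq> y1" "x3 \<noteq> y2" "x3 \<noteq> y3"
  "y1 \<noteq> y2" "y1 \<noteq> y3" "y2 \<noteq> y3"
  using distinct_frame by auto

lemmas distinct_simps [simp] = neqs neqs[symmetric]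

lemma UNIV_frame: "(UNIV :: hook set) = {b, n1, n2, n3, x1, x2, x3, y1, y2, y3}"
proof (rule card_subset_eq[symmetric])
  show "card {b, n1, n2, n3, x1, x2, x3, y1, y2, y3} = card (UNIV :: hook set)"
    by (simp add: UNIV_hook)
qed simp_all

lemma neighbours:
  "{a. a \<sim> b} = {n1, n2, n3}"
  "{a. a \<sim> n1} = {b, x1, y1}" "{a. a \<sim> n2} = {b, x2, y2}" "{a. a \<sim> n3} = {b, x3, y3}"
  "{a. a \<sim> x1} = {n1, y2, y3}" "{a. a \<sim> x2} = {n2, y1, y3}" "{a. a \<sim> x3} = {n3, y1, y2}"
  "{a. a \<sim> y1} = {n1, x2, x3}" "{a. a \<sim> y2} = {n2, x1, x3}" "{a. a \<sim> y3} = {n3, x1, x2}"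
  by (auto simp: adj_def edges doubleton_eq_iff)

lemma cl_b: "cl b = {b, n1, n2, n3}"
  by (auto simp: cl_def neighbours)

lemma flip_prod_frame:
  "flip_prod U V J =
     (if b \<in> J then V b else U b) *
     ((if n1 \<in> J then V n1 else U n1) * (if n2 \<in> J then V n2 else U n2) *
      (if n3 \<in> J then V n3 else U n3) *
      ((if x1 \<in> J then V x1 else U x1) * (if x2 \<in> J then V x2 else U x2) *
       (if x3 \<in> J then V x3 else U x3) * (if y1 \<in> J then V y1 else U y1) *
       (if y2 \<in> J then V y2 else U y2) * (if y3 \<in> J then V y3 else U y3)))"
  unfolding flip_prod_def UNIV_frame
  by (simp only: prod.insert_if finite.intros insert_iff distinct_simps prod.empty empty_iff
      mult.assoc if_False simp_thms mult_1_right)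

lemma sum_edges:
  "(\<Sum>e\<in>petersen_edges. f e) = f {b, n1} + f {b, n2} + f {b, n3}
     + (f {n1, x1} + f {n1, y1} + f {n2, x2} + f {n2, y2} + f {n3, x3} + f {n3, y3})
     + (f {x1, y2} + f {x1, y3} + f {x2, y1} + f {x2, y3} + f {x3, y1} + f {x3, y2})"
  for f :: "hook set \<Rightarrow> 'a::comm_ring_1"
  unfolding edges by (simp add: doubleton_eq_iff add.assoc)

lemma sum_frame: "(\<Sum>a\<in>UNIV. f a) = f b + (f n1 + f n2 + f n3) + (f x1 + f x2 + f x3 + f y1 + f y2 + f y3)"
  for f :: "hook \<Rightarrow> 'a::comm_ring_1"
  unfolding UNIV_frame by (simp add: add.assoc)

lemma lr_poly_plus:
  fixes U V :: "hook \<Rightarrow> 'a::comm_ring_1"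
  assumes V: "\<And>a. V a = U a - t" and b: "U b = 0" and n: "U n1 + U n2 + U n3 = t"
  shows "lr_poly U V = flip_prod U V (cl b)"
proof -
  \<comment> \<open>The hexagon factors, which no surviving flip set (\<open>{b}\<close> or an edge
    at \<open>b\<close>) touches.\<close>
  define R where "R = U x1 * U x2 * U x3 * U y1 * U y2 * U y3"
  have "lr_poly U V = t * (2 * (U n1 * U n2 * U n3) - (U n1 - t) * U n2 * U n3 -
      U n1 * (U n2 - t) * U n3 - U n1 * U n2 * (U n3 - t)) * R"
    unfolding lr_poly_def sum_edges sum_frame flip_prod_frame R_def
    by (simp add: b V) (simp add: algebra_simps)
  \<comment> \<open>The factor \<open>- t\<close> left by \<open>star_identity\<close> is
    \<open>V b\<close>.\<close>
  also have "\<dots> = flip_prod U V (cl b)"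
    unfolding star_identity[OF n] by (simp add: flip_prod_frame cl_b V b R_def mult.assoc)
  finally show ?thesis .
qed

lemma lr_poly_minus:
  fixes U V :: "hook \<Rightarrow> 'a::comm_ring_1"
  assumes V: "\<And>a. V a = U a - t" and b: "U b = t"
    and n: "U n1 = U x1 + U y1" "U n2 = U x2 + U y2" "U n3 = U x3 + U y3"
    and x: "U x1 + U x2 + U x3 = t" and y: "U y1 + U y2 + U y3 = t"
  shows "lr_poly U V = flip_prod V U (cl b)"
proof -
  \<comment> \<open>Opaque names keep n_i = x_i + y_i from being expanded before the terms are
    grouped.\<close>
  define p1 p2 p3 q1 q2 q3 where defs: "p1 = U x1" "p2 = U x2" "p3 = U x3" "q1 = U y1" "q2 = U y2" "q3 = U y3"
  define m1 m2 m3 where m: "m1 = p1 + q1" "m2 = p2 + q2" "m3 = p3 + q3"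
  \<comment> \<open>The terms that flip hexagon hooks only, with the factors of \<open>b\<close> and
    the n_i removed.\<close>
  define S where "S = 7 * (p1*p2*p3*q1*q2*q3)
     - 2 * ((p1-t)*p2*p3*q1*q2*q3 + p1*(p2-t)*p3*q1*q2*q3 + p1*p2*(p3-t)*q1*q2*q3
          + p1*p2*p3*(q1-t)*q2*q3 + p1*p2*p3*q1*(q2-t)*q3 + p1*p2*p3*q1*q2*(q3-t))
     + ((p1-t)*p2*p3*q1*(q2-t)*q3 + (p1-t)*p2*p3*q1*q2*(q3-t)
      + p1*(p2-t)*p3*(q1-t)*q2*q3 + p1*(p2-t)*p3*q1*q2*(q3-t)
      + p1*p2*(p3-t)*(q1-t)*q2*q3 + p1*p2*(p3-t)*q1*(q2-t)*q3)"
  \<comment> \<open>Flips of \<open>b\<close> vanish since \<open>V b = 0\<close>; elsewhere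
    \<open>b\<close> contributes \<open>t\<close>. Each of the last three lines collects the flips
    of one n_i in the shape of \<open>spoke_identity\<close>.\<close>
  have "lr_poly U V = t * (m1 * m2 * m3 * S
     + m2 * m3 * ((m1-t)*((p1-t)*q1*(p2*p3*q2*q3) + p1*(q1-t)*(p2*p3*q2*q3)) - 2*((m1-t)*(p1*q1*(p2*p3*q2*q3))))
     + m1 * m3 * ((m2-t)*((p2-t)*q2*(p1*p3*q1*q3) + p2*(q2-t)*(p1*p3*q1*q3)) - 2*((m2-t)*(p2*q2*(p1*p3*q1*q3))))
     + m1 * m2 * ((m3-t)*((p3-t)*q3*(p1*p2*q1*q2) + p3*(q3-t)*(p1*p2*q1*q2)) - 2*((m3-t)*(p3*q3*(p1*p2*q1*q2)))))"
    unfolding lr_poly_def sum_edges sum_frame flip_prod_frame S_def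
    by (simp add: b V n defs[symmetric] m[symmetric]) (simp add: algebra_simps)
  also have "\<dots> = t * (m1 * m2 * m3 * (S - t * ((m1-t)*p2*p3*q2*q3 + (m2-t)*p1*p3*q1*q3 + (m3-t)*p1*p2*q1*q2)))"
    unfolding m spoke_identity unfolding m[symmetric] by (simp add: algebra_simps)
  also have "\<dots> = t * (m1 * m2 * m3 * ((p1-t)*(p2-t)*(p3-t)*((q1-t)*(q2-t)*(q3-t))))"
    using hexagon_identity[OF x y] unfolding S_def m defs by simp
  also have "\<dots> = flip_prod V U (cl b)"
    by (simp add: flip_prod_frame cl_b V b n m defs mult.assoc)
  finally show ?thesis .
qed

end

text \<open>Vertex transitivity of the graph, made explicit by one frame per hook.\<close>

lemma petersen_frame_exists: "\<exists>n1 n2 n3 x1 x2 x3 y1 y2 y3. petersen_frame b n1 n2 n3 x1 x2 x3 y1 y2 y3"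
proof -
  have "petersen_frame A1 Bt3 C5 A2 C2 B1 C3 B2 C4 A3"
    "petersen_frame A2 A1 A3 C3 Bt3 B1 C4 C5 C2 B2"
    "petersen_frame A3 C2 B1 A2 C4 B2 A1 Bt3 C5 C3"
    "petersen_frame B1 C5 B2 A3 A1 C3 C2 C4 Bt3 A2"
    "petersen_frame B2 Bt3 C3 B1 C2 A2 C5 A1 C4 A3"
    "petersen_frame Bt3 C2 A1 B2 C4 A2 B1 A3 C5 C3"
    "petersen_frame C2 C4 Bt3 A3 C5 B2 A2 C3 A1 B1"
    "petersen_frame C3 C4 B2 A2 C2 B1 A1 C5 Bt3 A3"
    "petersen_frame C4 C2 C5 C3 Bt3 B1 A2 A3 A1 B2"
    "petersen_frame C5 A1 C4 B1 Bt3 C3 A3 A2 C2 B2"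
    by (simp_all add: petersen_frame_def petersen_edges_def insert_commute)
  then show ?thesis
    by (cases b) blast+
qed


section \<open>Ideals and congruences\<close>

locale ring_ideal =
  fixes K :: "'a::comm_ring_1 set"
  assumes zero_mem: "0 \<in> K"
    and add_mem: "x \<in> K \<Longrightarrow> y \<in> K \<Longrightarrow> x + y \<in> K"
    and mult_mem: "x \<in> K \<Longrightarrow> r * x \<in> K"
begin

lemma uminus_mem: "x \<in> K \<Longrightarrow> - x \<in> K"
  using mult_mem[of x "-1"] by simp

lemma diff_mem: "x \<in> K \<Longrightarrow> y \<in> K \<Longrightarrow> x - y \<in> K"
  using add_mem[of x "- y"] uminus_mem[of y] by simp

lemma cong_add: "a - a' \<in> K \<Longrightarrow> c - c' \<in> K \<Longrightarrow> (a + c) - (a' + c') \<in> K"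
  using add_mem[of "a - a'" "c - c'"] by (simp add: algebra_simps)

lemma cong_mult: "a - a' \<in> K \<Longrightarrow> c - c' \<in> K \<Longrightarrow> a * c - a' * c' \<in> K"
  using add_mem[OF mult_mem[of "c - c'" a] mult_mem[of "a - a'" c']] by (simp add: algebra_simps)

lemma cong_sum: "(\<And>i. i \<in> I \<Longrightarrow> f i - g i \<in> K) \<Longrightarrow> sum f I - sum g I \<in> K"
  by (induction I rule: infinite_finite_induct) (auto simp: zero_mem intro!: cong_add)

lemma cong_prod: "(\<And>i. i \<in> I \<Longrightarrow> f i - g i \<in> K) \<Longrightarrow> prod f I - prod g I \<in> K"
  by (induction I rule: infinite_finite_induct) (auto simp: zero_mem intro!: cong_mult)

lemma cong_flip_prod:
  assumes "\<And>a. U a - U' a \<in> K" "\<And>a. V a - V' a \<in> K"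
  shows "flip_prod U V J - flip_prod U' V' J \<in> K"
  unfolding flip_prod_def by (rule cong_prod) (simp add: assms)

lemma cong_lr_poly:
  assumes "\<And>a. U a - U' a \<in> K" "\<And>a. V a - V' a \<in> K"
  shows "lr_poly U V - lr_poly U' V' \<in> K"
proof -
  have flip: "r * flip_prod U V J - r * flip_prod U' V' J \<in> K" for r J
    using mult_mem[OF cong_flip_prod[OF assms]] by (simp add: algebra_simps)
  \<comment> \<open>Coefficients are moved inside the sums, including a 1, so that every term has
    the form covered by \<open>flip\<close>.\<close>
  have "(7 * flip_prod U V {} + (\<Sum>b\<in>UNIV. - 2 * flip_prod U V {b}) + (\<Sum>e\<in>petersen_edges. 1 * flip_prod U V e))
    - (7 * flip_prod U' V' {} + (\<Sum>b\<in>UNIV. - 2 * flip_prod U' V' {b}) + (\<Sum>e\<in>petersen_edges. 1 * flip_prod U' V' e)) \<in> K"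
    by (intro cong_add cong_sum flip)
  then show ?thesis
    by (simp add: lr_poly_def sum_distrib_left sum_negf)
qed

end

lemma module_times: "module ((*) :: 'a::comm_ring_1 \<Rightarrow> 'a \<Rightarrow> 'a)"
  by unfold_locales (simp_all add: algebra_simps)

lemma ring_ideal_ideal_gen: "ring_ideal (ideal_gen S)"
  unfolding ideal_gen_def
  by standard (intro module.span_zero[OF module_times] module.span_add[OF module_times]
      module.span_scale[OF module_times]; assumption)+

lemma ideal_gen_base: "a \<in> S \<Longrightarrow> a \<in> ideal_gen S"
  unfolding ideal_gen_def by (rule module.span_base[OF module_times])

lemma ideal_gen_minimal: "S \<subseteq> K \<Longrightarrow> ring_ideal K \<Longrightarrow> ideal_gen S \<subseteq> K"
  unfolding ideal_gen_def ring_ideal_def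
  by (intro module.span_minimal[OF module_times] module.subspaceI[OF module_times]) auto

text \<open>Makes the sum of ideals in the theorem a generated ideal, so that the
  \<open>ring_ideal\<close> rules apply to it.\<close>

lemma ideal_gen_Un: "ideal_gen (S \<union> T) = ideal_gen S + ideal_gen T"
  unfolding ideal_gen_def by (auto simp: module.span_Un[OF module_times] set_plus_def)

lemma ring_ideal_hook_ideal_plus: "ring_ideal (hook_ideal + ideal_gen {u})"
  unfolding hook_ideal_def ideal_gen_Un[symmetric] by (rule ring_ideal_ideal_gen)

lemma hook_ideal_subset_plus: "hook_ideal \<subseteq> hook_ideal + ideal_gen {u}"
  unfolding hook_ideal_def ideal_gen_Un[symmetric]
  by (rule ideal_gen_minimal) (auto intro: ideal_gen_base ring_ideal_ideal_gen)

lemma generator_mem_hook_ideal_plus: "u \<in> hook_ideal + ideal_gen {u}"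
  unfolding hook_ideal_def ideal_gen_Un[symmetric] by (rule ideal_gen_base) simp

lemma const_half: "const (1/2) + const (1/2) = 1"
  by (simp add: const_def flip: single_add)

lemma u_minus_eq: "u_minus a = u_plus a - \<beta>"
proof -
  have "u_plus a - u_minus a = (const (1/2) + const (1/2)) * \<beta>"
    by (simp add: u_plus_def u_minus_def algebra_simps)
  then show ?thesis by (simp add: const_half algebra_simps)
qed

lemma card_neighbours: "card {c. c \<sim> a} = 3"
proof -
  obtain n1 n2 n3 x1 x2 x3 y1 y2 y3 where "petersen_frame a n1 n2 n3 x1 x2 x3 y1 y2 y3"
    using petersen_frame_exists by blast
  then interpret petersen_frame a n1 n2 n3 x1 x2 x3 y1 y2 y3 .
  show ?thesis by (simp add: neighbours)
qed

text \<open>Half the generator at \<open>a\<close>: the three neighbours carry three halves of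
  \<open>\<beta>\<close> and \<open>a\<close> carries one half, hence the correction by one
  \<open>\<beta>\<close>.\<close>

lemma u_plus_relation: "u_plus a - ((\<Sum>c | c \<sim> a. u_plus c) - \<beta>) \<in> hook_ideal"
proof -
  have "const (1/2) * (ell a - (\<Sum>c | c \<sim> a. ell c)) \<in> hook_ideal"
    unfolding hook_ideal_def
    by (intro ring_ideal.mult_mem[OF ring_ideal_ideal_gen] ideal_gen_base rangeI)
  moreover have "u_plus a - ((\<Sum>c | c \<sim> a. u_plus c) - \<beta>)
      = const (1/2) * (ell a - (\<Sum>c | c \<sim> a. ell c)) + (\<beta> - (const (1/2) + const (1/2)) * \<beta>)"
    by (simp add: u_plus_def sum.distrib sum_distrib_left card_neighbours algebra_simps)
  ultimately show ?thesis by (simp add: const_half)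
qed

section \<open>The two congruences, and eigenvectors for the eigenvalue 1\<close>

context petersen_frame
begin

lemma F_cong_X: "F - X (cl b) \<in> hook_ideal + ideal_gen {u_plus b}" (is "_ \<in> ?K")
proof -
  interpret ring_ideal ?K
    by (rule ring_ideal_hook_ideal_plus)
  have ub: "u_plus b \<in> ?K"
    by (rule generator_mem_hook_ideal_plus)
  have rel: "u_plus b - (u_plus n1 + u_plus n2 + u_plus n3 - \<beta>) \<in> ?K"
    using subsetD[OF hook_ideal_subset_plus u_plus_relation[of b]] by (simp add: neighbours add.assoc)
  \<comment> \<open>The relation at \<open>b\<close> is solved for \<open>n3\<close>, so the
    hypotheses of \<open>lr_poly_plus\<close> hold as equalities.\<close>
  define U where "U = u_plus(b := 0, n3 := \<beta> - u_plus n1 - u_plus n2)"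
  define V where "V a = U a - \<beta>" for a
  have U: "u_plus a - U a \<in> ?K" for a
    using ub diff_mem[OF ub rel] by (auto simp: U_def zero_mem algebra_simps)
  have V: "u_minus a - V a \<in> ?K" for a
    using U[of a] by (simp add: V_def u_minus_eq)
  have "lr_poly U V = flip_prod U V (cl b)"
    by (rule lr_poly_plus[where t = \<beta>]) (simp_all add: V_def U_def)
  then show ?thesis
    using diff_mem[OF cong_lr_poly[of u_plus U u_minus V] cong_flip_prod[of u_plus U u_minus V "cl b"], OF U V U V]
    by (simp add: F_eq_lr_poly X_eq_flip_prod)
qed

lemma F_cong_X_bar: "F - X_bar (cl b) \<in> hook_ideal + ideal_gen {u_minus b}" (is "_ \<in> ?K")
proof -
  interpret ring_ideal ?K
    by (rule ring_ideal_hook_ideal_plus)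
  have ub: "u_plus b - \<beta> \<in> ?K"
    using generator_mem_hook_ideal_plus[of "u_minus b"] by (simp add: u_minus_eq)
  have rel: "u_plus a - ((\<Sum>c | c \<sim> a. u_plus c) - \<beta>) \<in> ?K" for a
    using hook_ideal_subset_plus u_plus_relation by blast
  \<comment> \<open>Replacing \<open>b\<close> by \<open>\<beta>\<close> cancels the
    \<open>\<beta>\<close> in the relation at each n_i.\<close>
  have n1: "u_plus n1 - (u_plus x1 + u_plus y1) \<in> ?K"
    using add_mem[OF rel[of n1] ub] by (simp add: neighbours algebra_simps)
  have n2: "u_plus n2 - (u_plus x2 + u_plus y2) \<in> ?K"
    using add_mem[OF rel[of n2] ub] by (simp add: neighbours algebra_simps)
  have n3: "u_plus n3 - (u_plus x3 + u_plus y3) \<in> ?K"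
    using add_mem[OF rel[of n3] ub] by (simp add: neighbours algebra_simps)
  \<comment> \<open>The relation at \<open>y1\<close> involves \<open>n1\<close>, \<open>x2\<close>,
    \<open>x3\<close>; substituting for \<open>n1\<close> cancels \<open>y1\<close> and leaves the
    sum of the x_i. The relation at \<open>x1\<close> does the same for the y_i.\<close>
  have x: "u_plus x3 - (\<beta> - u_plus x1 - u_plus x2) \<in> ?K"
    using uminus_mem[OF add_mem[OF rel[of y1] n1]] by (simp add: neighbours algebra_simps)
  have y: "u_plus y3 - (\<beta> - u_plus y1 - u_plus y2) \<in> ?K"
    using uminus_mem[OF add_mem[OF rel[of x1] n1]] by (simp add: neighbours algebra_simps)
  have n3': "u_plus n3 - ((\<beta> - u_plus x1 - u_plus x2) + (\<beta> - u_plus y1 - u_plus y2)) \<in> ?K"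
    using add_mem[OF n3 add_mem[OF x y]] by (simp add: algebra_simps)
  \<comment> \<open>Only \<open>x1\<close>, \<open>x2\<close>, \<open>y1\<close>, \<open>y2\<close>
    stay free; all other symbols are expressed through these and \<open>\<beta>\<close>.\<close>
  define U where "U = u_plus(b := \<beta>, x3 := \<beta> - u_plus x1 - u_plus x2, y3 := \<beta> - u_plus y1 - u_plus y2,
    n1 := u_plus x1 + u_plus y1, n2 := u_plus x2 + u_plus y2,
    n3 := (\<beta> - u_plus x1 - u_plus x2) + (\<beta> - u_plus y1 - u_plus y2))"
  define V where "V a = U a - \<beta>" for a
  have U: "u_plus a - U a \<in> ?K" for a
    using ub n1 n2 n3' x y by (simp add: U_def zero_mem)
  have V: "u_minus a - V a \<in> ?K" for a
    using U[of a] by (simp add: V_def u_minus_eq)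
  have "lr_poly U V = flip_prod V U (cl b)"
    by (rule lr_poly_minus[where t = \<beta>]) (simp_all add: V_def U_def)
  then show ?thesis
    using diff_mem[OF cong_lr_poly[of u_plus U u_minus V] cong_flip_prod[of u_minus V u_plus U "cl b"], OF U V V U]
    by (simp add: F_eq_lr_poly X_bar_eq_flip_prod)
qed

lemma eigenvector_vanishing_only_at:
  "\<exists>f :: hook \<Rightarrow> rat. (\<forall>a. f a = (\<Sum>c | c \<sim> a. f c)) \<and> (\<forall>a. f a = 0 \<longleftrightarrow> a = b)"
proof -
  \<comment> \<open>With value 0 at \<open>b\<close>, any x_i and y_i each summing to zero, with n_i
    = x_i + y_i, give an eigenvector. These numbers keep the other nine values nonzero.\<close>
  define f :: "hook \<Rightarrow> rat" where "f = (\<lambda>_. 0)(x1 := 1, x2 := 2, x3 := -3, y1 := 10, y2 := 20, y3 := -30,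
    n1 := 11, n2 := 22, n3 := -33)"
  have "\<forall>a\<in>UNIV. f a = (\<Sum>c | c \<sim> a. f c)" "\<forall>a\<in>UNIV. f a = 0 \<longleftrightarrow> a = b"
    unfolding UNIV_frame by (simp_all add: neighbours f_def)
  then show ?thesis by blast
qed

lemma eigenvector_one_at:
  "\<exists>f :: hook \<Rightarrow> rat. (\<forall>a. f a = (\<Sum>c | c \<sim> a. f c)) \<and> f b = 1"
proof -
  \<comment> \<open>The value depends only on the distance to \<open>n1\<close>: 3 at
    \<open>n1\<close>, 1 on its neighbours, -1 elsewhere.\<close>
  define f :: "hook \<Rightarrow> rat" where "f = (\<lambda>_. -1)(b := 1, x1 := 1, y1 := 1, n1 := 3)"
  have "\<forall>a\<in>UNIV. f a = (\<Sum>c | c \<sim> a. f c)" "f b = 1"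
    unfolding UNIV_frame by (simp_all add: neighbours f_def)
  then show ?thesis by blast
qed

end

section \<open>Evaluation at points\<close>

definition eval_monom :: "(var \<Rightarrow> rat) \<Rightarrow> (var \<Rightarrow>\<^sub>0 nat) \<Rightarrow> rat" where
  "eval_monom x m = (\<Prod>v\<in>Poly_Mapping.keys m. x v ^ Poly_Mapping.lookup m v)"

text \<open>Allows monomials of different support to be compared over one index set; the added
  factors are zeroth powers.\<close>

lemma eval_monom_superset:
  assumes "finite A" "Poly_Mapping.keys m \<subseteq> A"
  shows "eval_monom x m = (\<Prod>v\<in>A. x v ^ Poly_Mapping.lookup m v)"
  unfolding eval_monom_def
  by (rule prod.mono_neutral_left) (use assms in \<open>auto simp: in_keys_iff\<close>)

lemma eval_monom_add: "eval_monom x (m + n) = eval_monom x m * eval_monom x n"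
proof -
  let ?A = "Poly_Mapping.keys m \<union> Poly_Mapping.keys n"
  have "eval_monom x k = (\<Prod>v\<in>?A. x v ^ Poly_Mapping.lookup k v)" if "k \<in> {m, n, m + n}" for k
    by (rule eval_monom_superset) (use that keys_add[of m n] in auto)
  then show ?thesis
    by (simp add: lookup_add power_add prod.distrib)
qed

lemma eval_at_superset:
  assumes "finite A" "Poly_Mapping.keys p \<subseteq> A"
  shows "eval_at x p = (\<Sum>m\<in>A. Poly_Mapping.lookup p m * eval_monom x m)"
  unfolding eval_at_def eval_monom_def
  by (rule sum.mono_neutral_left) (use assms in \<open>auto simp: in_keys_iff\<close>)

lemma eval_at_zero [simp]: "eval_at x 0 = 0"
  by (simp add: eval_at_def)

lemma eval_at_single: "eval_at x (Poly_Mapping.single m c) = c * eval_monom x m"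
  by (subst eval_at_superset[of "{m}"]) auto

lemma eval_at_add: "eval_at x (p + q) = eval_at x p + eval_at x q"
proof -
  let ?A = "Poly_Mapping.keys p \<union> Poly_Mapping.keys q"
  have "eval_at x r = (\<Sum>m\<in>?A. Poly_Mapping.lookup r m * eval_monom x m)" if "r \<in> {p, q, p + q}" for r
    by (rule eval_at_superset) (use that keys_add[of p q] in auto)
  then show ?thesis
    by (simp add: lookup_add distrib_right sum.distrib)
qed

lemma eval_at_sum: "eval_at x (\<Sum>i\<in>I. f i) = (\<Sum>i\<in>I. eval_at x (f i))"
  by (induction I rule: infinite_finite_induct) (simp_all add: eval_at_add)

lemma poly_mapping_eq_sum_single:
  "p = (\<Sum>m\<in>Poly_Mapping.keys p. Poly_Mapping.single m (Poly_Mapping.lookup p m))"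
  by (rule poly_mapping_eqI) (simp add: lookup_sum lookup_single when_def in_keys_iff)

lemma eval_at_mult: "eval_at x (p * q) = eval_at x p * eval_at x q"
proof -
  let ?lp = "Poly_Mapping.lookup p" and ?lq = "Poly_Mapping.lookup q"
  have "p * q = (\<Sum>m\<in>Poly_Mapping.keys p. Poly_Mapping.single m (?lp m))
              * (\<Sum>n\<in>Poly_Mapping.keys q. Poly_Mapping.single n (?lq n))"
    by (simp flip: poly_mapping_eq_sum_single)
  also have "eval_at x \<dots> = (\<Sum>m\<in>Poly_Mapping.keys p. \<Sum>n\<in>Poly_Mapping.keys q.
      (?lp m * eval_monom x m) * (?lq n * eval_monom x n))"
    by (simp add: sum_product mult_single eval_at_sum eval_at_single eval_monom_add mult_ac)
  also have "\<dots> = eval_at x p * eval_at x q"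
    by (simp add: sum_product eval_at_def eval_monom_def)
  finally show ?thesis .
qed

lemma eval_at_const [simp]: "eval_at x (const c) = c"
  by (simp add: const_def eval_at_single eval_monom_def)

lemma eval_at_indet [simp]: "eval_at x (indet v) = x v"
  by (simp add: indet_def eval_at_single eval_monom_def)

lemma eval_at_one [simp]: "eval_at x 1 = 1"
  using eval_at_const[of x 1] by (simp add: const_def)

lemma eval_at_diff: "eval_at x (p - q) = eval_at x p - eval_at x q"
  using eval_at_add[of x "p - q" q] by simp

lemma eval_at_prod: "eval_at x (\<Prod>i\<in>I. f i) = (\<Prod>i\<in>I. eval_at x (f i))"
  by (induction I rule: infinite_finite_induct) (simp_all add: eval_at_mult)

lemma eval_at_u_plus: "eval_at x (u_plus a) = (x (Ell a) + x Beta) / 2"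
  and eval_at_u_minus: "eval_at x (u_minus a) = (x (Ell a) - x Beta) / 2"
  by (simp_all add: u_plus_def u_minus_def eval_at_mult eval_at_add eval_at_diff)

text \<open>With \<open>ideal_gen_minimal\<close>, vanishing on a generated ideal need only be
  checked on generators.\<close>

lemma ring_ideal_vanishing: "ring_ideal {p. eval_at x p = 0}"
  by standard (simp_all add: eval_at_add eval_at_mult)

text \<open>The generators do not involve \<open>\<beta>\<close>, so its value \<open>t\<close> is
  free.\<close>

lemma eigenvector_in_hook_space:
  assumes f: "\<And>a. f a = (\<Sum>c | c \<sim> a. f c)"
  shows "case_var t f \<in> hook_space"
proof -
  have "eval_at (case_var t f) (ell a - (\<Sum>c | c \<sim> a. ell c)) = 0" for a
    by (simp add: eval_at_diff eval_at_sum flip: f)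
  then have "hook_ideal \<subseteq> {p. eval_at (case_var t f) p = 0}"
    unfolding hook_ideal_def by (intro ideal_gen_minimal ring_ideal_vanishing) blast
  then show ?thesis by (auto simp: hook_space_def)
qed

text \<open>Both summands of the ideal vanish at \<open>x\<close>: the first because
  \<open>x\<close> lies in the hook space, the second because \<open>u\<close> does.\<close>

lemma eval_at_eq_on_hyperplane:
  assumes "p - q \<in> hook_ideal + ideal_gen {u}" "x \<in> hyperplane u"
  shows "eval_at x p = eval_at x q"
proof -
  obtain r s where "p - q = r + s" "r \<in> hook_ideal" "s \<in> ideal_gen {u}"
    using assms(1) by (rule set_plus_elim)
  moreover have "ideal_gen {u} \<subseteq> {p. eval_at x p = 0}"
    using assms(2) by (intro ideal_gen_minimal ring_ideal_vanishing) (simp add: hyperplane_def)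
  ultimately have "eval_at x (p - q) = 0"
    using assms(2) by (auto simp: eval_at_add hyperplane_def hook_space_def)
  then show ?thesis by (simp add: eval_at_diff)
qed

section \<open>Counting the hyperplanes\<close>

definition u_sign :: "bool \<Rightarrow> hook \<Rightarrow> hpoly" where
  "u_sign s = (if s then u_plus else u_minus)"

lemma hook_hyperplanes_eq: "hook_hyperplanes = (\<lambda>(s, b). hyperplane (u_sign s b)) ` UNIV"
  proof -
  have *: "(UNIV :: (bool \<times> hook) set) = range (Pair True) \<union> range (Pair False)"
    by auto
  show ?thesis
    unfolding * by (simp only: hook_hyperplanes_def image_Un image_image u_sign_def prod.case if_True if_False)
qed

lemma inj_hyperplane: "inj (\<lambda>(s, b). hyperplane (u_sign s b))"
proof (rule injI, clarify)
  fix s b s' b' assume eq: "hyperplane (u_sign s b) = hyperplane (u_sign s' b')"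
  obtain n1 n2 n3 x1 x2 x3 y1 y2 y3 where "petersen_frame b n1 n2 n3 x1 x2 x3 y1 y2 y3"
    using petersen_frame_exists by blast
  then interpret petersen_frame b n1 n2 n3 x1 x2 x3 y1 y2 y3 .
  obtain f :: "hook \<Rightarrow> rat" where f: "\<And>a. f a = (\<Sum>c | c \<sim> a. f c)" "\<And>a. f a = 0 \<longleftrightarrow> a = b"
    using eigenvector_vanishing_only_at by blast
  \<comment> \<open>At \<open>\<beta>\<close> = 0 both signs impose the same condition, so this
    point detects the hook alone.\<close>
  have "case_var 0 f \<in> hyperplane (u_sign s b)"
    using eigenvector_in_hook_space[OF f(1)]
    by (simp add: hyperplane_def u_sign_def eval_at_u_plus eval_at_u_minus f(2))
  then have "case_var 0 f \<in> hyperplane (u_sign s' b')"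
    by (simp only: eq)
  then have b': "b' = b"
    by (auto simp: hyperplane_def u_sign_def eval_at_u_plus eval_at_u_minus f(2) split: if_splits)
  obtain g :: "hook \<Rightarrow> rat" where g: "\<And>a. g a = (\<Sum>c | c \<sim> a. g c)" "g b = 1"
    using eigenvector_one_at by blast
  \<comment> \<open>With value 1 at \<open>b\<close>, the choice of \<open>\<beta>\<close> as -1 or
    1 puts the point on exactly one of the two hyperplanes of \<open>b\<close>.\<close>
  have "case_var (if s then - 1 else 1) g \<in> hyperplane (u_sign s b)"
    using eigenvector_in_hook_space[OF g(1)]
    by (simp add: hyperplane_def u_sign_def eval_at_u_plus eval_at_u_minus g(2))
  then have "case_var (if s then - 1 else 1) g \<in> hyperplane (u_sign s' b)"
    by (simp only: eq b')
  then have "s' = s"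
    by (auto simp: hyperplane_def u_sign_def eval_at_u_plus eval_at_u_minus g(2) split: if_splits)
  then show "s = s' \<and> b = b'" using b' by simp
qed

lemma card_hook: "card (UNIV :: hook set) = 10"
  by (simp add: UNIV_hook)

lemma card_hook_hyperplanes: "card hook_hyperplanes = 20"
proof -
  have "card hook_hyperplanes = card (UNIV :: (bool \<times> hook) set)"
    unfolding hook_hyperplanes_eq by (rule card_image[OF inj_hyperplane])
  also have "\<dots> = 20"
    unfolding UNIV_Times_UNIV[symmetric] card_cartesian_product by (simp add: card_hook)
  finally show ?thesis .
qed

section \<open>Linear factors and the final statement\<close>

lemma u_plus_single: "u_plus a = Poly_Mapping.single (Poly_Mapping.single (Ell a) 1) (1/2)
    + Poly_Mapping.single (Poly_Mapping.single Beta 1) (1/2)"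
  and u_minus_single: "u_minus a = Poly_Mapping.single (Poly_Mapping.single (Ell a) 1) (1/2)
    + Poly_Mapping.single (Poly_Mapping.single Beta 1) (-1/2)"
  by (simp_all add: u_plus_def u_minus_def const_def indet_def distrib_left right_diff_distrib mult_single
      single_uminus)

lemma linear_form_u_plus: "linear_form (u_plus a)"
proof -
  \<comment> \<open>Evaluates to 1/2, which shows that the form is nonzero.\<close>
  have "eval_at (case_var 0 (\<lambda>_. 1)) (u_plus a) \<noteq> 0"
    by (simp add: eval_at_u_plus)
  then have "u_plus a \<noteq> 0" by auto
  then show ?thesis
    unfolding linear_form_def using keys_add by (fastforce simp: u_plus_single)
qed

lemma linear_form_u_minus: "linear_form (u_minus a)"
proof -
  have "eval_at (case_var 0 (\<lambda>_. 1)) (u_minus a) \<noteq> 0"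
    by (simp add: eval_at_u_minus)
  then have "u_minus a \<noteq> 0" by auto
  then show ?thesis
    unfolding linear_form_def using keys_add by (fastforce simp: u_minus_single)
qed

lemma flip_prod_linear_factors:
  assumes "\<And>a. linear_form (U a)" "\<And>a. linear_form (V a)"
  shows "\<exists>L :: nat \<Rightarrow> hpoly. (\<forall>i<10. linear_form (L i)) \<and>
    (\<forall>x. eval_at x (flip_prod U V (J :: hook set)) = (\<Prod>i<10. eval_at x (L i)))"
proof -
  \<comment> \<open>An enumeration of the ten hooks turns the product over hooks into one over
    indices below 10.\<close>
  obtain h :: "nat \<Rightarrow> hook" where h: "bij_betw h {..<10} (UNIV :: hook set)"
    using ex_bij_betw_nat_finite[of "UNIV :: hook set"] by (auto simp: card_hook atLeast0LessThan)
  let ?g = "\<lambda>a. if a \<in> J then V a else U a"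
  have "eval_at x (flip_prod U V J) = (\<Prod>i<10. eval_at x (?g (h i)))" for x
    unfolding flip_prod_def eval_at_prod by (rule prod.reindex_bij_betw[OF h, symmetric])
  with assms show ?thesis by (intro exI[of _ "\<lambda>i. ?g (h i)"]) auto
qed

theorem mainTheorem2:
  shows "(\<forall>b. F - X (cl b) \<in> hook_ideal + ideal_gen {u_plus b}
            \<and> F - X_bar (cl b) \<in> hook_ideal + ideal_gen {u_minus b})
       \<and> card hook_hyperplanes = 20
       \<and> (\<forall>P\<in>hook_hyperplanes. \<exists>L :: nat \<Rightarrow> hpoly.
            (\<forall>i<10. linear_form (L i)) \<and> (\<forall>x\<in>P. eval_at x F = (\<Prod>i<10. eval_at x (L i))))"
proof (intro conjI ballI)
  show *: "\<forall>b. F - X (cl b) \<in> hook_ideal + ideal_gen {u_plus b}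
            \<and> F - X_bar (cl b) \<in> hook_ideal + ideal_gen {u_minus b}"
    by (meson petersen_frame.F_cong_X petersen_frame.F_cong_X_bar petersen_frame_exists)
  show "card hook_hyperplanes = 20"
    by (rule card_hook_hyperplanes)
  fix P assume "P \<in> hook_hyperplanes"
  then consider b where "P = hyperplane (u_plus b)" | b where "P = hyperplane (u_minus b)"
    by (auto simp: hook_hyperplanes_def)
  then show "\<exists>L :: nat \<Rightarrow> hpoly. (\<forall>i<10. linear_form (L i)) \<and>
      (\<forall>x\<in>P. eval_at x F = (\<Prod>i<10. eval_at x (L i)))"
  proof cases
    case 1
    then have "\<forall>x\<in>P. eval_at x F = eval_at x (flip_prod u_plus u_minus (cl b))"
      using * eval_at_eq_on_hyperplane unfolding X_eq_flip_prod by blast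
    then show ?thesis
      using flip_prod_linear_factors[of u_plus u_minus "cl b"] linear_form_u_plus linear_form_u_minus by auto
  next
    case 2
    then have "\<forall>x\<in>P. eval_at x F = eval_at x (flip_prod u_minus u_plus (cl b))"
      using * eval_at_eq_on_hyperplane unfolding X_bar_eq_flip_prod by blast
    then show ?thesis
      using flip_prod_linear_factors[of u_minus u_plus "cl b"] linear_form_u_plus linear_form_u_minus by auto
  qed
qed

end
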